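(* Consider the encoding channel $\mathcal{E}_H^*:\mathcal{B}(\mathcal{H}_{1/2})\to\mathcal{B}(\mathcal{H}_{1/2}\otimes\mathcal{H}_{1/2})$, $\mathcal{E}_H^*(\rho)=V\rho V^\dagger$, with $V=|\Psi^-\rangle\langle\uparrow|+|\Psi^+\rangle\langle\downarrow|$. Its Choi–Jamiołkowski state $J(\mathcal{E}_H^* )$ is a pure state exhibiting maximal entanglement between the reference system and the output subsystem. Concretely, $$J(\mathcal{E}_H^* )=|\Psi_{\mathrm{Choi}}\rangle\langle\Psi_{\mathrm{Choi}}|,\qquad |\Psi_{\mathrm{Choi}}\rangle=\frac1{\sqrt2}\big(|\uparrow\rangle_R\otimes|\Psi^-\rangle_B+|\downarrow\rangle_R\otimes|\Psi^+\rangle_B\big),$$ where $R$ labels the reference qubit and $B$ the output two-qubit system. The entanglement entropy across the $R|B$ partition is $$S(\rho_R)=S(\rho_B)=1\ \text{ebit},$$ with $\rho_R=\operatorname{Tr}_BJ(\mathcal{E}_H^* )$ and $\rho_B=\operatorname{Tr}_RJ(\mathcal{E}_H^* )$. This shows that $\mathcal{E}_H^*$ perfectly preserves one ebit of entanglement with a reference system, achieving the theoretical maximum for an encoding from one qubit to two qubits restricted to the Bell subspace $\mathcal{S}=\operatorname{span}\{|\Psi^-\rangle,|\Psi^+\rangle\}$.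
   Context: $\mathcal{H}_{1/2}=\mathbb{C}^2$ with orthonormal basis $|\uparrow\rangle,|\downarrow\rangle$; $|\Psi^\pm\rangle=\frac1{\sqrt2}(|\uparrow\downarrow\rangle\pm|\downarrow\uparrow\rangle)\in\mathcal{H}_{1/2}\otimes\mathcal{H}_{1/2}$ are two Bell states, and $\mathcal{S}\subset\mathcal{H}_{1/2}\otimes\mathcal{H}_{1/2}$ is their two-dimensional span, which is the image of the isometry $V$. $\mathcal{B}(\mathcal{H})$ is the algebra of linear operators on $\mathcal{H}$. For a quantum channel (completely positive trace-preserving map) $\Lambda:\mathcal{B}(\mathcal{H}_{\mathrm{in}})\to\mathcal{B}(\mathcal{H}_{\mathrm{out}})$ with $d_{\mathrm{in}}=\dim\mathcal{H}_{\mathrm{in}}$, its Choi–Jamiołkowski state is $J(\Lambda)=(\mathrm{id}\otimes\Lambda)(|\Omega\rangle\langle\Omega|)$, where $|\Omega\rangle=\frac1{\sqrt{d_{\mathrm{in}}}}\sum_{i}|i\rangle_R\otimes|i\rangle_{\mathrm{in}}$ is a maximally entangled state between a reference system $\mathcal{H}_R\cong\mathcal{H}_{\mathrm{in}}$ and the input system. Here $\mathcal{H}_{\mathrm{in}}=\mathcal{H}_{1/2}$, the reference basis is identified with $|\uparrow\rangle,|\downarrow\rangle$, and the output system is $\mathcal{H}_B=\mathcal{H}_{1/2}\otimes\mathcal{H}_{1/2}$. $S(\rho)=-\operatorname{Tr}(\rho\log_2\rho)$ is the von Neumann entropy, measured in ebits, and $\operatorname{Tr}_B,\operatorname{Tr}_R$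 are partial traces. *)

theory Defs
  imports "HOL-Analysis.Analysis"
begin

section \<open>Vectors and operators\<close>

text \<open>
  Operators are matrices over finite index types, and the tensor product of spaces indexed by
  \<open>'a\<close> and \<open>'b\<close> is the space indexed by \<open>'a \<times> 'b\<close>. The library's real-valued inner product on
  \<open>complex ^ 'n\<close> is not the Hermitian one, which is therefore introduced here
  (antilinear in the first argument); the library's \<open>norm\<close> is the Hilbert space norm.
\<close>

definition cinner :: "complex ^ 'n \<Rightarrow> complex ^ 'n \<Rightarrow> complex"
  where "cinner v w = (\<Sum>i\<in>UNIV. cnj (v $ i) * w $ i)"

definition adj :: "complex ^ 'n ^ 'm \<Rightarrow> complex ^ 'm ^ 'n"
  where "adj A = (\<chi> i j. cnj (A $ j $ i))"

definition ketbra :: "complex ^ 'm \<Rightarrow> complex ^ 'n \<Rightarrow> complex ^ 'n ^ 'm"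
  where "ketbra v w = (\<chi> i j. v $ i * cnj (w $ j))"

definition tensor :: "complex ^ 'a \<Rightarrow> complex ^ 'b \<Rightarrow> complex ^ ('a::finite \<times> 'b::finite)"  (infixr "\<otimes>\<^sub>v" 75)
  where "v \<otimes>\<^sub>v w = (\<chi> p. v $ fst p * w $ snd p)"

definition ptrace_snd :: "complex ^ ('a::finite \<times> 'b::finite) ^ ('a::finite \<times> 'b::finite) \<Rightarrow> complex ^ 'a ^ 'a"
  where "ptrace_snd X = (\<chi> i j. \<Sum>k\<in>UNIV. X $ (i, k) $ (j, k))"

definition ptrace_fst :: "complex ^ ('a::finite \<times> 'b::finite) ^ ('a::finite \<times> 'b::finite) \<Rightarrow> complex ^ 'b ^ 'b"
  where "ptrace_fst X = (\<chi> k l. \<Sum>i\<in>UNIV. X $ (i, k) $ (i, l))"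

definition psd :: "complex ^ 'n ^ 'n \<Rightarrow> bool"
  where "psd A \<longleftrightarrow> (\<forall>v. cinner v (A *v v) \<in> \<real>\<^sub>\<ge>\<^sub>0)"

definition density :: "complex ^ 'n ^ 'n \<Rightarrow> bool"
  where "density \<rho> \<longleftrightarrow> psd \<rho> \<and> trace \<rho> = 1"

definition pure_state :: "complex ^ 'n ^ 'n \<Rightarrow> bool"
  where "pure_state \<rho> \<longleftrightarrow> (\<exists>\<psi>. norm \<psi> = 1 \<and> \<rho> = ketbra \<psi> \<psi>)"

definition supported_on :: "(complex ^ 'n) set \<Rightarrow> complex ^ 'n ^ 'n \<Rightarrow> bool"
  where "supported_on S \<rho> \<longleftrightarrow> range ((*v) \<rho>) \<subseteq> S"

definition orthonormal_fam :: "nat \<Rightarrow> (nat \<Rightarrow> complex ^ 'n) \<Rightarrow> bool"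
  where "orthonormal_fam d e \<longleftrightarrow>
    (\<forall>i<d. \<forall>j<d. cinner (e i) (e j) = (if i = j then 1 else 0))"

text \<open>All Schmidt coefficients equal, with the largest Schmidt rank the dimensions allow.\<close>

definition maximally_entangled :: "complex ^ ('a::finite \<times> 'b::finite) \<Rightarrow> bool"
  where "maximally_entangled \<psi> \<longleftrightarrow>
    (let d = min CARD('a) CARD('b) in
      \<exists>(e :: nat \<Rightarrow> complex ^ 'a) (f :: nat \<Rightarrow> complex ^ 'b).
        orthonormal_fam d e \<and> orthonormal_fam d f \<and>
        \<psi> = complex_of_real (1 / sqrt (real d)) *s (\<Sum>i<d. e i \<otimes>\<^sub>v f i))"


section \<open>Von Neumann entropy\<close>

definition diag_mat :: "('n \<Rightarrow> real) \<Rightarrow> complex ^ 'n ^ 'n"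
  where "diag_mat d = (\<chi> i j. if i = j then complex_of_real (d i) else 0)"

definition unitary_mat :: "complex ^ 'n ^ 'n \<Rightarrow> bool"
  where "unitary_mat U \<longleftrightarrow> adj U ** U = mat 1 \<and> U ** adj U = mat 1"

text \<open>
  Functional calculus for Hermitian matrices: if \<open>A\<close> is unitarily diagonalised with real
  eigenvalues \<open>d\<close>, apply \<open>f\<close> to the eigenvalues. The result does not depend on the
  diagonalisation (lemma \<open>spectral_fun_eqI\<close> below); for non-Hermitian \<open>A\<close> the value is unspecified.
\<close>

definition spectral_fun :: "(real \<Rightarrow> real) \<Rightarrow> complex ^ 'n ^ 'n \<Rightarrow> complex ^ 'n ^ 'n"
  where "spectral_fun f A = (THE B. \<exists>U d. unitary_mat U \<and>
    A = U ** diag_mat d ** adj U \<and> B = U ** diag_mat (f \<circ> d) ** adj U)"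

text \<open>
  Since \<open>log 2 0 = 0\<close> in the library, and in any case the factor \<open>\<rho>\<close> annihilates its own kernel,
  the convention \<open>0 log 0 = 0\<close> is respected. The trace is real for density operators.
\<close>

definition vn_entropy :: "complex ^ 'n ^ 'n \<Rightarrow> real"
  where "vn_entropy \<rho> = - Re (trace (\<rho> ** spectral_fun (log 2) \<rho>))"

lemma diag_mat_mult: "diag_mat d ** W = (\<chi> i j. complex_of_real (d i) * W $ i $ j)"
  by (simp add: diag_mat_def matrix_matrix_mult_def vec_eq_iff if_distrib[of "\<lambda>x. x * _"]
      sum.delta cong: if_cong)

lemma mult_diag_mat: "W ** diag_mat d = (\<chi> i j. W $ i $ j * complex_of_real (d j))"
  by (simp add: diag_mat_def matrix_matrix_mult_def vec_eq_iff if_distrib[of "\<lambda>x. _ * x"]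
      sum.delta cong: if_cong)

lemma spectral_fun_unique:
  assumes U: "unitary_mat U" and U': "unitary_mat U'"
    and eq: "U ** diag_mat d ** adj U = U' ** diag_mat d' ** adj U'"
  shows "U ** diag_mat (f \<circ> d) ** adj U = U' ** diag_mat (f \<circ> d') ** adj U'"
proof -
  define W where "W = adj U' ** U"
  have conj: "adj U' ** (U ** D ** adj U) ** U = W ** D" for D
    using U by (simp add: W_def unitary_mat_def flip: matrix_mul_assoc)
  have conj': "adj U' ** (U' ** D ** adj U') ** U = D ** W" for D
  proof -
    have "adj U' ** (U' ** D ** adj U') ** U = (adj U' ** U') ** D ** W"
      by (simp add: W_def matrix_mul_assoc)
    then show ?thesis using U' by (simp add: unitary_mat_def)
  qed
  have bk: "U' ** (adj U' ** X ** U) ** adj U = X" for X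
  proof -
    have "U' ** (adj U' ** X ** U) ** adj U = (U' ** adj U') ** X ** (U ** adj U)"
      by (simp add: matrix_mul_assoc)
    then show ?thesis using U U' by (simp add: unitary_mat_def)
  qed
  have "W ** diag_mat d = diag_mat d' ** W"
    using eq conj conj' by metis
  then have "W $ i $ j * complex_of_real (d j) = complex_of_real (d' i) * W $ i $ j" for i j
    by (simp add: diag_mat_mult mult_diag_mat vec_eq_iff)
  then have "W $ i $ j = 0 \<or> d j = d' i" for i j
    by (metis mult.commute mult_cancel_left of_real_eq_iff)
  then have "W ** diag_mat (f \<circ> d) = diag_mat (f \<circ> d') ** W"
    by (simp add: diag_mat_mult mult_diag_mat vec_eq_iff) (metis mult.commute mult_zero_left)
  then show ?thesis
    using conj conj' bk by metis
qed

lemma spectral_fun_eqI: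
  assumes "unitary_mat U" "A = U ** diag_mat d ** adj U"
  shows "spectral_fun f A = U ** diag_mat (f \<circ> d) ** adj U"
  unfolding spectral_fun_def
  by (rule the_equality) (use assms spectral_fun_unique in blast)+


section \<open>Quantum channels and the Choi--Jamiolkowski state\<close>

abbreviation mat_scale :: "complex \<Rightarrow> complex ^ 'n ^ 'm \<Rightarrow> complex ^ 'n ^ 'm"
  where "mat_scale c \<equiv> map_matrix ((*) c)"

text \<open>
  \<open>block_psd n X\<close>: the operator on the tensor product of an \<open>n\<close>-dimensional ancilla with the
  system, given by its \<open>n \<times> n\<close> array \<open>X\<close> of blocks, is positive semidefinite. Arrays indexed by
  natural numbers allow the ancilla dimension to be quantified over in \<open>completely_positive\<close>.
\<close>

definition block_psd :: "nat \<Rightarrow> (nat \<Rightarrow> nat \<Rightarrow> complex ^ 'a ^ 'a) \<Rightarrow> bool"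
  where "block_psd n X \<longleftrightarrow>
    (\<forall>v :: nat \<Rightarrow> complex ^ 'a. (\<Sum>i<n. \<Sum>j<n. cinner (v i) (X i j *v v j)) \<in> \<real>\<^sub>\<ge>\<^sub>0)"

definition completely_positive :: "(complex ^ 'a ^ 'a \<Rightarrow> complex ^ 'b ^ 'b) \<Rightarrow> bool"
  where "completely_positive \<Lambda> \<longleftrightarrow>
    (\<forall>n X. block_psd n X \<longrightarrow> block_psd n (\<lambda>i j. \<Lambda> (X i j)))"

definition quantum_channel :: "(complex ^ 'a ^ 'a \<Rightarrow> complex ^ 'b ^ 'b) \<Rightarrow> bool"
  where "quantum_channel \<Lambda> \<longleftrightarrow>
    Vector_Spaces.linear mat_scale mat_scale \<Lambda> \<and> completely_positive \<Lambda> \<and>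
    (\<forall>X. trace (\<Lambda> X) = trace X)"

text \<open>The map \<open>id \<otimes> \<Lambda>\<close> applies \<open>\<Lambda>\<close> to each block; cf. lemma \<open>id_tensor_product\<close> below.\<close>

definition id_tensor :: "(complex ^ 'a ^ 'a \<Rightarrow> complex ^ 'b ^ 'b) \<Rightarrow>
    complex ^ ('r::finite \<times> 'a::finite) ^ ('r::finite \<times> 'a::finite) \<Rightarrow> complex ^ ('r::finite \<times> 'b::finite) ^ ('r::finite \<times> 'b::finite)"
  where "id_tensor \<Lambda> X =
    (\<chi> p q. \<Lambda> (\<chi> a b. X $ (fst p, a) $ (fst q, b)) $ snd p $ snd q)"

lemma id_tensor_product:
  assumes "Vector_Spaces.linear mat_scale mat_scale \<Lambda>"
  shows "id_tensor \<Lambda> (\<chi> p q. A $ fst p $ fst q * Y $ snd p $ snd q)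
    = (\<chi> p q. A $ fst p $ fst q * \<Lambda> Y $ snd p $ snd q)"
proof -
  have "\<Lambda> (\<chi> a b. c * Y $ a $ b) $ k $ l = c * \<Lambda> Y $ k $ l" for c k l
    using module_hom.scale[OF assms[folded module_hom_iff_linear], of c Y] by (simp add: map_matrix_def vec_eq_iff)
  then show ?thesis by (simp add: id_tensor_def vec_eq_iff)
qed

definition max_ent_vec :: "complex ^ ('a::finite \<times> 'a)"
  where "max_ent_vec =
    complex_of_real (1 / sqrt (real CARD('a))) *s (\<Sum>i\<in>UNIV. axis i 1 \<otimes>\<^sub>v axis i 1)"

definition choi_state ::
    "(complex ^ 'a ^ 'a \<Rightarrow> complex ^ 'b ^ 'b) \<Rightarrow> complex ^ ('a::finite \<times> 'b::finite) ^ ('a::finite \<times> 'b::finite)"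
  where "choi_state \<Lambda> = id_tensor \<Lambda> (ketbra max_ent_vec max_ent_vec)"


section \<open>The Bell subspace encoding\<close>

datatype spin = Up | Down

instance spin :: finite
proof
  have "(UNIV :: spin set) = {Up, Down}" by (auto intro: spin.exhaust)
  then show "finite (UNIV :: spin set)" by (metis finite.emptyI finite.insertI)
qed

type_synonym qubit = "complex ^ spin"
type_synonym two_qubit = "complex ^ (spin \<times> spin)"

definition ket_up :: qubit where "ket_up = axis Up 1"

definition ket_down :: qubit where "ket_down = axis Down 1"

definition bell_plus :: two_qubit
  where "bell_plus =
    complex_of_real (1 / sqrt 2) *s (ket_up \<otimes>\<^sub>v ket_down + ket_down \<otimes>\<^sub>v ket_up)"

definition bell_minus :: two_qubit
  where "bell_minus =
    complex_of_real (1 / sqrt 2) *s (ket_up \<otimes>\<^sub>v ket_down - ket_down \<otimes>\<^sub>v ket_up)"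

text \<open>\<open>vec.span\<close> is the span with complex scalars.\<close>

definition bell_subspace :: "two_qubit set"
  where "bell_subspace = vec.span {bell_minus, bell_plus}"

definition V_enc :: "complex ^ spin ^ (spin \<times> spin)"
  where "V_enc = ketbra bell_minus ket_up + ketbra bell_plus ket_down"

definition enc_channel ::
    "complex ^ spin ^ spin \<Rightarrow> complex ^ (spin \<times> spin) ^ (spin \<times> spin)"
  where "enc_channel \<rho> = V_enc ** \<rho> ** adj V_enc"

definition choi_vec :: "complex ^ (spin \<times> (spin \<times> spin))"
  where "choi_vec =
    complex_of_real (1 / sqrt 2) *s (ket_up \<otimes>\<^sub>v bell_minus + ket_down \<otimes>\<^sub>v bell_plus)"

text \<open>Encodings of one qubit into two qubits whose output states live on the Bell subspace.\<close>

definition bell_encoding ::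
    "(complex ^ spin ^ spin \<Rightarrow> complex ^ (spin \<times> spin) ^ (spin \<times> spin)) \<Rightarrow> bool"
  where "bell_encoding \<Lambda> \<longleftrightarrow> quantum_channel \<Lambda> \<and>
    (\<forall>\<rho>. density \<rho> \<longrightarrow> supported_on bell_subspace (\<Lambda> \<rho>))"

end

theory Submission
  imports Defs
begin

text \<open>
  The marginals of the Choi state of a channel are the maximally mixed state on the reference (trace
  preservation) and the image of the maximally mixed input on the output. For a Bell encoding the
  latter is a density operator \<open>\<rho>\<close> whose range lies in the range of the isometry \<open>V\<close>, so
  \<open>\<rho> = V ** M ** adj V\<close> with a qubit density matrix \<open>M\<close> of the same nonzero spectrum, and its
  entropy is a binary entropy. Equality holds for the encoding at hand because there \<open>M\<close> is
  maximally mixed.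
\<close>

section \<open>Adjoints and positive semidefinite matrices\<close>

lemma adj_adj [simp]: "adj (adj A) = A"
  by (simp add: adj_def vec_eq_iff)

lemma adj_mult: "adj (A ** B) = adj B ** adj A"
  by (simp add: adj_def matrix_matrix_mult_def vec_eq_iff mult.commute)

lemma adj_mat_1: "adj (mat 1) = mat 1"
  by (auto simp: adj_def mat_def vec_eq_iff)

lemma cinner_adj: "cinner (adj A *v x) y = cinner x (A *v y)"
proof -
  have "cinner (adj A *v x) y = (\<Sum>i\<in>UNIV. \<Sum>j\<in>UNIV. cnj (x $ j) * (A $ j $ i * y $ i))"
    by (simp add: cinner_def adj_def matrix_vector_mult_def sum_distrib_left sum_distrib_right mult_ac)
  also have "\<dots> = (\<Sum>j\<in>UNIV. \<Sum>i\<in>UNIV. cnj (x $ j) * (A $ j $ i * y $ i))"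
    by (rule sum.swap)
  also have "\<dots> = cinner x (A *v y)"
    by (simp add: cinner_def matrix_vector_mult_def sum_distrib_left)
  finally show ?thesis .
qed

lemma cinner_add_left: "cinner (x + y) z = cinner x z + cinner y z"
  by (simp add: cinner_def algebra_simps sum.distrib)

lemma cinner_axis: "cinner (axis i c) x = cnj c * x $ i"
  by (simp add: cinner_def axis_def if_distrib[of cnj] if_distrib[of "\<lambda>x. x * _"] cong: if_cong)

lemma matrix_axis: "(A *v axis j c) $ i = A $ i $ j * c"
  by (simp add: matrix_vector_mult_def axis_def if_distrib[of "\<lambda>x. _ * x"] cong: if_cong)

lemma psd_conj:
  assumes "psd A"
  shows "psd (adj B ** A ** B)"
  unfolding psd_def
proof
  fix v
  have "cinner v ((adj B ** A ** B) *v v) = cinner (B *v v) (A *v (B *v v))"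
    using cinner_adj[of "adj B" v "A *v (B *v v)"] by (simp add: matrix_vector_mul_assoc matrix_mul_assoc)
  then show "cinner v ((adj B ** A ** B) *v v) \<in> \<real>\<^sub>\<ge>\<^sub>0"
    using assms by (simp add: psd_def)
qed

lemma psd_diagonal: "psd A \<Longrightarrow> A $ i $ i \<in> \<real>\<^sub>\<ge>\<^sub>0"
  unfolding psd_def by (drule spec[of _ "axis i 1"]) (simp add: cinner_axis matrix_axis)

text \<open>Polarisation: the quadratic form is real at \<open>axis i 1 + axis j z\<close> for every
  \<open>z\<close>, and so are its diagonal contributions, which leaves a real cross term.\<close>

lemma psd_hermitian:
  assumes "psd A"
  shows "adj A = A"
proof -
  have real: "cinner v (A *v v) \<in> \<real>" for v
    using assms nonneg_Reals_subset_Reals by (auto simp: psd_def)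
  have pol: "z * A $ i $ j + cnj z * A $ j $ i \<in> \<real>" for i j z
  proof -
    let ?v = "axis i 1 + axis j z"
    have zz: "cnj z * z \<in> \<real>"
      by (simp add: complex_is_Real_iff)
    have "cinner ?v (A *v ?v)
      = A $ i $ i + cnj z * z * A $ j $ j + (z * A $ i $ j + cnj z * A $ j $ i)"
      by (simp add: cinner_add_left cinner_axis matrix_vector_right_distrib matrix_axis algebra_simps)
    moreover have "A $ i $ i + cnj z * z * A $ j $ j \<in> \<real>"
      using zz psd_diagonal[OF assms, of i] psd_diagonal[OF assms, of j] nonneg_Reals_subset_Reals
      by (blast intro: Reals_add Reals_mult)
    ultimately show ?thesis
      using real[of ?v] Reals_diff by fastforce
  qed
  have "cnj (A $ j $ i) = A $ i $ j" for i j
    \<comment> \<open>\<open>z = 1\<close> matches the imaginary parts of the two entries,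
      \<open>z = \<i>\<close> the real parts.\<close>
    using pol[of 1 i j] pol[of \<i> i j] by (auto simp: complex_is_Real_iff complex_eq_iff)
  then show ?thesis
    by (simp add: adj_def vec_eq_iff)
qed

section \<open>Entropy in terms of eigenvalues\<close>

lemma vn_entropy_diagonalised:
  assumes "unitary_mat U" "A = U ** diag_mat d ** adj U"
  shows "vn_entropy A = (\<Sum>i\<in>UNIV. - (d i * log 2 (d i)))"
proof -
  have "A ** spectral_fun (log 2) A
      = U ** diag_mat d ** (adj U ** U) ** diag_mat (log 2 \<circ> d) ** adj U"
    unfolding spectral_fun_eqI[OF assms] by (subst assms(2)) (simp add: matrix_mul_assoc)
  also have "\<dots> = U ** (diag_mat d ** diag_mat (log 2 \<circ> d)) ** adj U"
    using assms(1) by (simp add: unitary_mat_def matrix_mul_assoc)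
  finally have "trace (A ** spectral_fun (log 2) A)
      = trace (adj U ** U ** (diag_mat d ** diag_mat (log 2 \<circ> d)))"
    by (metis trace_mul_sym matrix_mul_assoc)
  also have "\<dots> = trace (diag_mat d ** diag_mat (log 2 \<circ> d))"
    using assms(1) by (simp add: unitary_mat_def)
  also have "\<dots> = of_real (\<Sum>i\<in>UNIV. d i * log 2 (d i))"
    unfolding trace_def diag_mat_mult by (simp add: diag_mat_def)
  finally show ?thesis
    by (simp add: vn_entropy_def sum_negf)
qed

text \<open>The tangent to \<open>- x * log 2 x\<close> at the binary maximally mixed value \<open>x = 1 / 2\<close>.\<close>

lemma neg_x_log_x_le:
  fixes x :: real
  assumes "0 \<le> x"
  shows "- (x * log 2 x) \<le> x - (x - 1/2) / ln 2"
proof (cases "x = 0")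
  case False
  with assms have x: "x > 0" by simp
  \<comment> \<open>\<open>ln y \<le> y - 1\<close> at \<open>y = 1 / (2 * x)\<close>, with equality
    exactly at the tangent point \<open>x = 1/2\<close>.\<close>
  then have "- ln (2 * x) \<le> 1 / (2 * x) - 1"
    using ln_le_minus_one[of "1 / (2 * x)"] by (simp add: ln_div)
  then have "x * (- ln (2 * x)) \<le> x * (1 / (2 * x) - 1)"
    using x by (intro mult_left_mono) auto
  then have "- (x * ln x) \<le> x * ln 2 - (x - 1/2)"
    using x by (simp add: ln_mult algebra_simps)
  then have "- (x * ln x) / ln 2 \<le> (x * ln 2 - (x - 1/2)) / ln 2"
    by (intro divide_right_mono) auto
  then show ?thesis
    by (simp add: log_def diff_divide_distrib)
qed simp

section \<open>Qubit matrices: sums over spins, binary entropy, diagonalisation\<close>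

lemma UNIV_spin: "UNIV = {Up, Down}"
  by (auto intro: spin.exhaust)

lemma CARD_spin [simp]: "CARD(spin) = 2"
  by (simp add: UNIV_spin)

lemma sum_spin: "(\<Sum>s\<in>UNIV. f s) = f Up + f Down"
  by (simp add: UNIV_spin)

lemma sum_UNIV_prod: "(\<Sum>p\<in>UNIV. f p) = (\<Sum>i\<in>UNIV. \<Sum>j\<in>UNIV. f (i, j))"
  by (simp add: sum.cartesian_product flip: UNIV_Times_UNIV)

lemma all_spin: "(\<forall>s. P s) \<longleftrightarrow> P Up \<and> P Down"
  by (metis spin.exhaust)

text \<open>The tangent bounds are added up; their slope terms cancel because the two values sum to
  1.\<close>

lemma binary_entropy_le_1:
  fixes d :: "spin \<Rightarrow> real"
  assumes "\<And>s. 0 \<le> d s" "(\<Sum>s\<in>UNIV. d s) = 1"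
  shows "(\<Sum>s\<in>UNIV. - (d s * log 2 (d s))) \<le> 1"
proof -
  have "(\<Sum>s\<in>UNIV. - (d s * log 2 (d s))) \<le> (\<Sum>s\<in>UNIV. d s - (d s - 1/2) / ln 2)"
    using assms(1) by (intro sum_mono neg_x_log_x_le)
  also have "\<dots> = (\<Sum>s\<in>UNIV. d s) - ((\<Sum>s\<in>UNIV. d s) - 1) / ln 2"
    by (simp add: sum_spin field_simps)
  finally show ?thesis
    using assms(2) by simp
qed

text \<open>The eigenvalues come from the quadratic formula. The diagonal case is split off because
  the eigenvector \<open>(c, t)\<close> may vanish when \<open>c = 0\<close>.\<close>

lemma hermitian_qubit_diagonalisable:
  fixes M :: "complex ^ spin ^ spin"
  assumes "adj M = M"
  obtains W d where "unitary_mat W" "M = W ** diag_mat d ** adj W"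
proof -
  define a b c where "a = Re (M $ Up $ Up)" and "b = Re (M $ Down $ Down)" and "c = M $ Up $ Down"
  have cnj_M: "cnj (M $ j $ i) = M $ i $ j" for i j
    using assms by (simp add: adj_def vec_eq_iff)
  have M: "M $ Up $ Up = of_real a" "M $ Down $ Down = of_real b" "M $ Up $ Down = c" "M $ Down $ Up = cnj c"
    using cnj_M[of Up Up] cnj_M[of Down Down] cnj_M[of Up Down]
    by (simp_all add: a_def b_def c_def complex_eq_iff)
  show thesis
  proof (cases "c = 0")
    case True
    have "unitary_mat (mat 1 :: complex ^ spin ^ spin)"
      by (simp add: unitary_mat_def adj_mat_1)
    moreover have "M = mat 1 ** diag_mat (\<lambda>s. if s = Up then a else b) ** adj (mat 1)"
      using M True by (simp add: adj_mat_1 vec_eq_iff all_spin diag_mat_def)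
    ultimately show thesis by (rule that)
  next
    case False
    txt \<open>\<open>a + t\<close> is the larger eigenvalue, with eigenvector \<open>(c, t)\<close>.\<close>
    define t where "t = ((b - a) + sqrt ((a - b)\<^sup>2 + 4 * (cmod c)\<^sup>2)) / 2"
    define r where "r = 1 / sqrt ((cmod c)\<^sup>2 + t\<^sup>2)"
    \<comment> \<open>Complex copies of \<open>t\<close> and \<open>r\<close>, so that the matrix
      identities below become polynomial identities over one field, within reach of
      \<open>algebra\<close>.\<close>
    define T R :: complex where "T = of_real t" and "R = of_real r"
    have TR: "cnj T = T" "cnj R = R"
      by (simp_all add: T_def R_def)
    have "(2 * t - (b - a))\<^sup>2 = (a - b)\<^sup>2 + 4 * (cmod c)\<^sup>2"
      unfolding t_def by (simp add: field_simps)
    \<comment> \<open>The characteristic equation of \<open>M\<close> at the eigenvalue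
      \<open>a + t\<close>.\<close>
    then have t: "t * t + a * t = b * t + (cmod c)\<^sup>2"
      by (simp add: power2_eq_square algebra_simps)
    have "(cmod c)\<^sup>2 + t\<^sup>2 > 0"
      using False by (simp add: add_pos_nonneg)
    then have r: "r * r * ((cmod c)\<^sup>2 + t * t) = 1"
      using False by (simp add: r_def power2_eq_square)
    have cc: "of_real ((cmod c)\<^sup>2) = c * cnj c"
      by (rule complex_norm_square)
    have R: "R * R * (c * cnj c + T * T) = 1"
      using arg_cong[OF r, of complex_of_real] unfolding of_real_mult of_real_add cc by (simp add: T_def R_def)
    have T: "T * T + of_real a * T = of_real b * T + c * cnj c"
      using arg_cong[OF t, of complex_of_real] unfolding of_real_mult of_real_add cc by (simp add: T_def)
    \<comment> \<open>The columns are the orthogonal eigenvectors \<open>(c, t)\<close> and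
      \<open>(- t, cnj c)\<close>, normalised by \<open>r\<close>.\<close>
    define W :: "complex ^ spin ^ spin" where
      "W = (\<chi> i j. R * (if i = Up then if j = Up then c else - T
                       else if j = Up then T else cnj c))"
    have W: "W $ Up $ Up = R * c" "W $ Up $ Down = - (R * T)" "W $ Down $ Up = R * T" "W $ Down $ Down = R * cnj c"
      by (simp_all add: W_def)
    define d where "d = (\<lambda>s. if s = Up then a + t else b - t)"
    have d: "complex_of_real (d Up) = of_real a + T" "complex_of_real (d Down) = of_real b - T"
      by (simp_all add: d_def T_def)
    have "adj W ** W = mat 1"
      unfolding vec_eq_iff all_spin
      by (simp add: adj_def mat_def matrix_matrix_mult_def sum_spin W TR)
        (use R in algebra)
    then have U: "unitary_mat W"
      using matrix_left_right_inverse by (auto simp: unitary_mat_def)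
    have "M ** W = W ** diag_mat d"
      unfolding mult_diag_mat vec_eq_iff all_spin
      by (simp add: matrix_matrix_mult_def sum_spin M W d) (use T in algebra)
    then have "M = W ** diag_mat d ** adj W"
      using U by (metis matrix_mul_assoc matrix_mul_rid unitary_mat_def)
    with U show thesis by (rule that)
  qed
qed

section \<open>Marginals of the maximally entangled state and of Choi states\<close>

lemma max_ent_vec_nth:
  "max_ent_vec $ (i, k) = (if i = k then complex_of_real (1 / sqrt (real CARD('a))) else 0)"
  for i k :: "'a::finite"
proof -
  have "(\<Sum>j\<in>UNIV. (axis j 1 \<otimes>\<^sub>v axis j 1 :: complex ^ ('a \<times> 'a)) $ (i, k))
      = (\<Sum>j\<in>UNIV. if j = i then if i = k then 1 else 0 else 0)"
    by (rule sum.cong) (auto simp: tensor_def axis_def)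
  then show ?thesis
    by (simp add: max_ent_vec_def)
qed

lemma max_ent_vec_marginal:
  "(\<Sum>k\<in>UNIV. max_ent_vec $ (i, k) * cnj (max_ent_vec $ (j, k)))
    = (if i = j then 1 / of_nat CARD('a) else 0)" for i j :: "'a::finite"
proof -
  have "complex_of_real (1 / sqrt (real CARD('a))) * cnj (complex_of_real (1 / sqrt (real CARD('a))))
      = 1 / of_nat CARD('a)"
    by (simp flip: of_real_mult)
  moreover have "(\<Sum>k\<in>UNIV. max_ent_vec $ (i, k) * cnj (max_ent_vec $ (j, k)))
     = (\<Sum>k\<in>UNIV. if k = i then if i = j then complex_of_real (1 / sqrt (real CARD('a)))
           * cnj (complex_of_real (1 / sqrt (real CARD('a)))) else 0 else 0)"
    by (rule sum.cong) (auto simp: max_ent_vec_nth)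
  ultimately show ?thesis by simp
qed

lemma ptrace_snd_max_ent_vec:
  "ptrace_snd (ketbra max_ent_vec max_ent_vec) = (mat (1 / of_nat CARD('a)) :: complex ^ 'a ^ 'a::finite)"
  by (simp add: ptrace_snd_def ketbra_def max_ent_vec_marginal mat_def vec_eq_iff)

lemma ptrace_fst_max_ent_vec:
  "ptrace_fst (ketbra max_ent_vec max_ent_vec) = (mat (1 / of_nat CARD('a)) :: complex ^ 'a ^ 'a::finite)"
proof -
  \<comment> \<open>Symmetry under exchange of the two factors turns one marginal into the
    other.\<close>
  have "max_ent_vec $ (i, k) = max_ent_vec $ (k, i)" for i k :: 'a
    by (simp add: max_ent_vec_nth)
  then have "ptrace_fst (ketbra max_ent_vec max_ent_vec)
      = (ptrace_snd (ketbra max_ent_vec max_ent_vec) :: complex ^ 'a ^ 'a)"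
    by (simp add: ptrace_fst_def ptrace_snd_def ketbra_def vec_eq_iff)
  then show ?thesis
    by (simp add: ptrace_snd_max_ent_vec)
qed

text \<open>Each entry of this marginal is the trace of a block, and applying
  \<open>\<Lambda>\<close> blockwise does not change these traces.\<close>

lemma ptrace_snd_choi_state:
  fixes \<Lambda> :: "complex ^ 'a ^ 'a \<Rightarrow> complex ^ 'b ^ 'b"
  assumes "\<And>X. trace (\<Lambda> X) = trace X"
  shows "ptrace_snd (choi_state \<Lambda>) = mat (1 / of_nat CARD('a))"
proof -
  have "(\<Sum>k\<in>UNIV. \<Lambda> X $ k $ k) = (\<Sum>k\<in>UNIV. X $ k $ k)" for X
    using assms by (simp add: trace_def)
  then have "ptrace_snd (choi_state \<Lambda>) = ptrace_snd (ketbra max_ent_vec max_ent_vec)"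
    by (simp add: ptrace_snd_def choi_state_def id_tensor_def ketbra_def)
  then show ?thesis
    by (simp add: ptrace_snd_max_ent_vec)
qed

text \<open>The diagonal blocks are summed; linearity moves the sum inside \<open>\<Lambda>\<close>,
  where it is the marginal of the input state.\<close>

lemma ptrace_fst_choi_state:
  fixes \<Lambda> :: "complex ^ 'a ^ 'a \<Rightarrow> complex ^ 'b ^ 'b"
  assumes "Vector_Spaces.linear mat_scale mat_scale \<Lambda>"
  shows "ptrace_fst (choi_state \<Lambda>) = \<Lambda> (mat (1 / of_nat CARD('a)))"
proof -
  let ?X = "\<lambda>i. \<chi> a b. ketbra max_ent_vec max_ent_vec $ (i, a) $ (i, b)"
  have "ptrace_fst (choi_state \<Lambda>) = (\<Sum>i\<in>UNIV. \<Lambda> (?X i))"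
    by (simp add: ptrace_fst_def choi_state_def id_tensor_def vec_eq_iff)
  also have "\<dots> = \<Lambda> (\<Sum>i\<in>UNIV. ?X i)"
    by (rule module_hom.sum[OF assms[folded module_hom_iff_linear], symmetric])
  also have "(\<Sum>i\<in>UNIV. ?X i) = ptrace_fst (ketbra max_ent_vec max_ent_vec)"
    by (simp add: ptrace_fst_def vec_eq_iff)
  finally show ?thesis
    by (simp add: ptrace_fst_max_ent_vec)
qed

section \<open>The maximally mixed qubit and conjugation channels\<close>

lemma unitary_mat_1: "unitary_mat (mat 1)"
  by (simp add: unitary_mat_def adj_mat_1)

lemma mat_half:
  "(mat (1 / 2) :: complex ^ spin ^ spin) = mat 1 ** diag_mat (\<lambda>_. 1 / 2) ** adj (mat 1)"
  by (simp add: adj_mat_1) (simp add: mat_def diag_mat_def vec_eq_iff)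

lemma vn_entropy_maximally_mixed_qubit: "vn_entropy (mat (1 / 2) :: complex ^ spin ^ spin) = 1"
  using vn_entropy_diagonalised[OF unitary_mat_1 mat_half] by (simp add: sum_spin log_divide)

text \<open>Moving \<open>B\<close> to the other side of \<open>cinner\<close> turns the block form
  at \<open>v i\<close> into the original block form at \<open>adj B *v v i\<close>.\<close>

lemma completely_positive_conj: "completely_positive (\<lambda>\<rho>. B ** \<rho> ** adj B)"
proof -
  have "cinner v ((B ** X ** adj B) *v w) = cinner (adj B *v v) (X *v (adj B *v w))" for v w X
    by (simp add: cinner_adj matrix_vector_mul_assoc matrix_mul_assoc)
  then show ?thesis
    by (auto simp: completely_positive_def block_psd_def)
qed

lemma vector_space_mat_scale: "vector_space mat_scale"
  by unfold_locales (simp_all add: map_matrix_def vec_eq_iff algebra_simps)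

lemma linear_conj: "Vector_Spaces.linear mat_scale mat_scale (\<lambda>\<rho>. B ** \<rho> ** adj B)"
  unfolding Vector_Spaces.linear_iff
proof (intro conjI allI vector_space_mat_scale)
  fix x y :: "complex ^ 'a ^ 'a"
  show "B ** (x + y) ** adj B = B ** x ** adj B + B ** y ** adj B"
    by (simp add: matrix_add_ldistrib)
      (simp add: matrix_matrix_mult_def vec_eq_iff algebra_simps sum.distrib)
next
  fix c and x :: "complex ^ 'a ^ 'a"
  have "B ** mat_scale c x = mat_scale c (B ** x)"
    by (simp add: matrix_matrix_mult_def map_matrix_def vec_eq_iff sum_distrib_left mult_ac)
  then show "B ** mat_scale c x ** adj B = mat_scale c (B ** x ** adj B)"
    by (simp add: matrix_matrix_mult_def map_matrix_def vec_eq_iff sum_distrib_left mult_ac)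
qed

lemma quantum_channel_conj:
  assumes "adj B ** B = mat 1"
  shows "quantum_channel (\<lambda>\<rho>. B ** \<rho> ** adj B)"
proof -
  have "trace (B ** X ** adj B) = trace X" for X
    using assms trace_mul_sym[of "B ** X" "adj B"] by (simp add: matrix_mul_assoc)
  then show ?thesis
    by (simp add: quantum_channel_def linear_conj completely_positive_conj)
qed

text \<open>Positivity is complete positivity with a one-dimensional ancilla.\<close>

lemma quantum_channel_psd:
  assumes "quantum_channel \<Lambda>" "psd \<rho>"
  shows "psd (\<Lambda> \<rho>)"
proof -
  have psd_iff: "psd A \<longleftrightarrow> block_psd 1 (\<lambda>_ _. A)" for A :: "complex ^ 'n ^ 'n"
    unfolding psd_def block_psd_def by (auto dest: spec[of _ "\<lambda>_. _"])
  show ?thesis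
    using assms unfolding quantum_channel_def completely_positive_def psd_iff by blast
qed

section \<open>The Bell subspace and its isometry\<close>

lemma ket_nth:
  "ket_up $ s = (if s = Up then 1 else 0)" "ket_down $ s = (if s = Up then 0 else 1)"
  by (cases s; simp add: ket_up_def ket_down_def axis_def)+

lemma bell_nth:
  "bell_minus $ (s, t) = (if s = t then 0 else if s = Up then 1 / sqrt 2 else - 1 / sqrt 2)"
  "bell_plus $ (s, t) = (if s = t then 0 else 1 / sqrt 2)"
  by (cases s; cases t; simp add: bell_minus_def bell_plus_def tensor_def ket_nth)+

lemma V_enc_nth: "V_enc $ p $ s = (if s = Up then bell_minus $ p else bell_plus $ p)"
  by (simp add: V_enc_def ketbra_def ket_nth)

lemma V_enc_mult_vec: "V_enc *v x = x $ Up *s bell_minus + x $ Down *s bell_plus"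
  by (simp add: matrix_vector_mult_def sum_spin V_enc_nth vec_eq_iff mult.commute)

lemma V_enc_isometry: "adj V_enc ** V_enc = mat 1"
  by (simp add: adj_def matrix_matrix_mult_def mat_def vec_eq_iff all_spin sum_UNIV_prod sum_spin
      V_enc_nth bell_nth flip: of_real_mult)

text \<open>Lets a support condition be used as a factorisation through
  \<open>V_enc\<close>.\<close>

lemma bell_subspace_eq: "bell_subspace = range ((*v) V_enc)"
proof
  show "range ((*v) V_enc) \<subseteq> bell_subspace"
  proof clarify
    fix x
    show "V_enc *v x \<in> bell_subspace"
      unfolding bell_subspace_def V_enc_mult_vec
      by (intro vec.span_add vec.span_scale) (simp_all add: vec.span_base)
  qed
  show "bell_subspace \<subseteq> range ((*v) V_enc)"
  proof
    fix y assume "y \<in> bell_subspace"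
    then obtain k l where "y - k *s bell_minus = l *s bell_plus"
      by (auto simp: bell_subspace_def vec.span_breakdown_eq[of _ bell_minus] vec.span_singleton)
    then have "y = V_enc *v (\<chi> s. if s = Up then k else l)"
      by (simp add: V_enc_mult_vec algebra_simps)
    then show "y \<in> range ((*v) V_enc)" by blast
  qed
qed

lemma bell_encoding_enc_channel: "bell_encoding enc_channel"
proof -
  have "quantum_channel enc_channel"
    using quantum_channel_conj[OF V_enc_isometry] by (simp add: enc_channel_def[abs_def])
  moreover have "supported_on bell_subspace (enc_channel \<rho>)" for \<rho>
    by (auto simp: supported_on_def bell_subspace_eq enc_channel_def simp flip: matrix_vector_mul_assoc)
  ultimately show ?thesis
    by (simp add: bell_encoding_def)
qed

section \<open>Entropy of states on the Bell subspace\<close>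

text \<open>The unitary \<open>W\<close> of the code space is completed to one of both qubits by the product vectors
  \<open>ket_up \<otimes>\<^sub>v ket_up\<close> and \<open>ket_down \<otimes>\<^sub>v ket_down\<close>, which are orthogonal to the Bell subspace.\<close>

lemma vn_entropy_encoded:
  assumes "unitary_mat W"
  shows "vn_entropy (V_enc ** (W ** diag_mat d ** adj W) ** adj V_enc)
    = (\<Sum>s\<in>UNIV. - (d s * log 2 (d s)))"
proof -
  define X where "X = V_enc ** W"
  \<comment> \<open>The second spin of the column index selects the kind of column:
    \<open>Up\<close> for encoded eigenvectors, \<open>Down\<close> for the added product vectors,
    which \<open>d'\<close> gives eigenvalue 0.\<close>
  define U :: "complex ^ (spin \<times> spin) ^ (spin \<times> spin)" where
    "U = (\<chi> p q. if snd q = Up then X $ p $ fst q else if p = (fst q, fst q) then 1 else 0)"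
  define d' where "d' = (\<lambda>(s, t). if t = Up then d s else 0)"
  have "adj X ** X = adj W ** (adj V_enc ** V_enc) ** W"
    by (simp add: X_def adj_mult matrix_mul_assoc)
  then have "adj X ** X = mat 1"
    using assms by (simp add: V_enc_isometry unitary_mat_def)
  then have XX: "(\<Sum>p\<in>UNIV. cnj (X $ p $ s) * X $ p $ s') = (if s = s' then 1 else 0)" for s s'
    by (simp add: adj_def matrix_matrix_mult_def mat_def vec_eq_iff)
  \<comment> \<open>Bell vectors have no component on equal spins; this makes the two kinds of
    columns orthogonal.\<close>
  have X0: "X $ (s, s) $ s' = 0" for s s'
    by (simp add: X_def matrix_matrix_mult_def sum_spin V_enc_nth bell_nth)
  have "(\<Sum>p\<in>UNIV. cnj (U $ p $ q) * U $ p $ q') = (if q = q' then 1 else 0)" for q q'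
  proof (cases q; cases q')
    fix s t s' t' assume [simp]: "q = (s, t)" "q' = (s', t')"
    show ?thesis
      by (cases t; cases t')
        (auto simp: U_def XX X0 if_distrib[of cnj] if_distrib[of "\<lambda>x. x * _"] if_distrib[of "\<lambda>x. _ * x"] cong: if_cong)
  qed
  then have "adj U ** U = mat 1"
    by (simp add: adj_def matrix_matrix_mult_def mat_def vec_eq_iff)
  then have U: "unitary_mat U"
    using matrix_left_right_inverse by (auto simp: unitary_mat_def)
  have "U ** diag_mat d' ** adj U = X ** diag_mat d ** adj X"
    unfolding mult_diag_mat
    by (simp add: matrix_matrix_mult_def adj_def vec_eq_iff sum_UNIV_prod sum_spin U_def d'_def)
  then have "V_enc ** (W ** diag_mat d ** adj W) ** adj V_enc = U ** diag_mat d' ** adj U"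
    by (simp add: X_def adj_mult matrix_mul_assoc)
  then show ?thesis
    using vn_entropy_diagonalised[OF U] by (simp add: sum_UNIV_prod sum_spin d'_def)
qed

text \<open>The bound comes from the dimension 2 of the subspace; on the whole four-dimensional
  output space the maximum would be 2.\<close>

lemma vn_entropy_bell_subspace_le_1:
  assumes "density \<rho>" and supp: "supported_on bell_subspace \<rho>"
  shows "vn_entropy \<rho> \<le> 1"
proof -
  have psd: "psd \<rho>" and tr: "trace \<rho> = 1"
    using assms(1) by (auto simp: density_def)
  define M where "M = adj V_enc ** \<rho> ** V_enc"
  \<comment> \<open>\<open>V_enc ** adj V_enc\<close> is the orthogonal projector onto the Bell
    subspace, so it fixes the range of \<open>\<rho>\<close>.\<close>
  have "V_enc ** adj V_enc *v (\<rho> *v x) = \<rho> *v x" for x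
  proof -
    obtain y where y: "\<rho> *v x = V_enc *v y"
      using supp by (auto simp: supported_on_def bell_subspace_eq)
    have "V_enc ** adj V_enc *v (V_enc *v y) = V_enc ** (adj V_enc ** V_enc) *v y"
      by (simp add: matrix_vector_mul_assoc matrix_mul_assoc)
    then show ?thesis
      by (simp add: y V_enc_isometry)
  qed
  then have P: "V_enc ** adj V_enc ** \<rho> = \<rho>"
    by (simp add: matrix_eq matrix_vector_mul_assoc)
  \<comment> \<open>The adjoint of \<open>P\<close>, as \<open>\<rho>\<close> and the projector are
    Hermitian.\<close>
  then have "\<rho> ** (V_enc ** adj V_enc) = \<rho>"
    using psd_hermitian[OF psd] by (metis adj_adj adj_mult)
  then have \<rho>: "\<rho> = V_enc ** M ** adj V_enc"
    using P by (simp add: M_def matrix_mul_assoc)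
  have "psd M"
    unfolding M_def by (rule psd_conj[OF psd])
  then obtain W d where W: "unitary_mat W" and M: "M = W ** diag_mat d ** adj W"
    using hermitian_qubit_diagonalisable psd_hermitian by metis
  have "adj W ** M ** W = (adj W ** W) ** diag_mat d ** (adj W ** W)"
    by (simp add: M matrix_mul_assoc)
  then have D: "adj W ** M ** W = diag_mat d"
    using W by (simp add: unitary_mat_def)
  \<comment> \<open>The eigenvalues are diagonal entries of a conjugate of the positive matrix
    \<open>M\<close>.\<close>
  then have "diag_mat d $ s $ s \<in> \<real>\<^sub>\<ge>\<^sub>0" for s
    using psd_diagonal[OF psd_conj[OF \<open>psd M\<close>, of W]] by simp
  then have nonneg: "0 \<le> d s" for s
    by (simp add: diag_mat_def)
  have "trace (diag_mat d) = trace (W ** (adj W ** M))"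
    unfolding D[symmetric] by (rule trace_mul_sym)
  also have "\<dots> = trace M"
    using W by (simp add: unitary_mat_def matrix_mul_assoc)
  also have "\<dots> = trace (V_enc ** (adj V_enc ** \<rho>))"
    unfolding M_def by (rule trace_mul_sym)
  also have "\<dots> = 1"
    using P tr by (simp add: matrix_mul_assoc)
  finally have "complex_of_real (\<Sum>s\<in>UNIV. d s) = 1"
    by (simp add: trace_def diag_mat_def)
  then have "(\<Sum>s\<in>UNIV. d s) = 1"
    by (simp only: of_real_eq_1_iff)
  then show ?thesis
    using binary_entropy_le_1 nonneg vn_entropy_encoded[OF W, of d] \<rho> M by metis
qed

section \<open>Marginal entropies of Bell encodings\<close>

lemma density_maximally_mixed_qubit: "density (mat (1 / 2) :: complex ^ spin ^ spin)"
proof -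
  have "cinner v (mat (1 / 2) *v v) \<in> \<real>\<^sub>\<ge>\<^sub>0" for v :: qubit
  proof -
    have "cinner v (mat (1 / 2) *v v) = of_real (\<Sum>s\<in>UNIV. (cmod (v $ s))\<^sup>2 / 2)"
      by (simp add: cinner_def matrix_vector_mult_def mat_def sum_spin complex_norm_square mult.commute
          del: of_real_power)
    then show ?thesis
      by (simp add: sum_nonneg del: of_real_sum)
  qed
  then show ?thesis
    by (simp add: density_def psd_def trace_def mat_def sum_spin)
qed

text \<open>A general encoding may have a mixed Choi state, whose marginals need not have equal
  entropy, so the two sides are argued separately.\<close>

lemma bell_encoding_entropies:
  assumes "bell_encoding \<Lambda>"
  shows "vn_entropy (ptrace_snd (choi_state \<Lambda>)) = 1"
    and "vn_entropy (ptrace_fst (choi_state \<Lambda>)) \<le> 1"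
proof -
  have chan: "quantum_channel \<Lambda>"
    using assms by (simp add: bell_encoding_def)
  then show "vn_entropy (ptrace_snd (choi_state \<Lambda>)) = 1"
    by (simp add: quantum_channel_def ptrace_snd_choi_state vn_entropy_maximally_mixed_qubit)
  have "density (\<Lambda> (mat (1 / 2)))"
    using chan quantum_channel_psd[OF chan] density_maximally_mixed_qubit
    by (simp add: density_def quantum_channel_def)
  moreover have "supported_on bell_subspace (\<Lambda> (mat (1 / 2)))"
    using assms density_maximally_mixed_qubit by (simp add: bell_encoding_def)
  moreover have "ptrace_fst (choi_state \<Lambda>) = \<Lambda> (mat (1 / 2))"
    using chan ptrace_fst_choi_state[of \<Lambda>] by (simp add: quantum_channel_def)
  ultimately show "vn_entropy (ptrace_fst (choi_state \<Lambda>)) \<le> 1"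
    by (simp add: vn_entropy_bell_subspace_le_1)
qed

text \<open>The output marginal is half the projector onto the Bell subspace: the encoding of a
  diagonal state with both eigenvalues \<open>1 / 2\<close>.\<close>

lemma vn_entropy_ptrace_fst_enc_channel: "vn_entropy (ptrace_fst (choi_state enc_channel)) = 1"
proof -
  have "ptrace_fst (choi_state enc_channel) = enc_channel (mat (1 / 2))"
    using bell_encoding_enc_channel ptrace_fst_choi_state[of enc_channel]
    by (simp add: bell_encoding_def quantum_channel_def)
  then show ?thesis
    using vn_entropy_encoded[OF unitary_mat_1, of "\<lambda>_. 1 / 2"]
    by (simp only: enc_channel_def mat_half) (simp add: sum_spin log_divide)
qed

section \<open>The Choi vector as the vectorised isometry\<close>

lemma choi_vec_nth: "choi_vec $ (s, p) = complex_of_real (1 / sqrt 2) * V_enc $ p $ s"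
  by (cases s; simp add: choi_vec_def tensor_def ket_nth V_enc_nth)

text \<open>Conjugation by \<open>V_enc\<close> sends the projector onto \<open>max_ent_vec\<close>
  to the projector onto its image under the identity tensored with \<open>V_enc\<close>, and that
  image is \<open>choi_vec\<close>.\<close>

lemma choi_state_enc_channel: "choi_state enc_channel = ketbra choi_vec choi_vec"
proof -
  have "(\<Sum>b\<in>UNIV. max_ent_vec $ (s, b) * V_enc $ p $ b) = choi_vec $ (s, p)" for s :: spin and p
    by (cases s; simp add: sum_spin max_ent_vec_nth choi_vec_nth)
  then have choi: "choi_vec $ (s, p) = max_ent_vec $ (s, Up) * V_enc $ p $ Up + max_ent_vec $ (s, Down) * V_enc $ p $ Down" for s p
    by (simp add: sum_spin)
  show ?thesis
    by (simp add: choi_state_def id_tensor_def ketbra_def enc_channel_def matrix_matrix_mult_def adj_def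
        vec_eq_iff sum_spin choi algebra_simps)
qed

lemma norm_choi_vec: "norm choi_vec = 1"
  by (simp add: norm_vec_def L2_set_def sum_UNIV_prod sum_spin choi_vec_nth V_enc_nth bell_nth
      norm_mult norm_divide power_mult_distrib power_divide)

lemma maximally_entangled_choi_vec: "maximally_entangled choi_vec"
proof -
  \<comment> \<open>The definition of \<open>choi_vec\<close> is already a Schmidt decomposition in
    these two families.\<close>
  let ?e = "\<lambda>i::nat. if i = 0 then ket_up else ket_down"
  let ?f = "\<lambda>i::nat. if i = 0 then bell_minus else bell_plus"
  have d: "min CARD(spin) CARD(spin \<times> spin) = 2"
    by simp
  have "orthonormal_fam 2 ?e"
    by (auto simp: orthonormal_fam_def less_2_cases_iff cinner_def sum_spin ket_nth)
  moreover have "orthonormal_fam 2 ?f"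
    by (auto simp: orthonormal_fam_def less_2_cases_iff cinner_def sum_UNIV_prod sum_spin bell_nth
        simp flip: of_real_mult)
  moreover have "choi_vec = complex_of_real (1 / sqrt (real 2)) *s (\<Sum>i<2. ?e i \<otimes>\<^sub>v ?f i)"
    by (simp add: choi_vec_def numeral_2_eq_2)
  ultimately show ?thesis
    unfolding maximally_entangled_def d Let_def by blast
qed

text \<open>Preservation is a comparison with the input: the conjuncts on \<open>max_ent_vec\<close>
  measure the ebit present before encoding. The last conjunct expresses optimality.\<close>

theorem theorem4p1:
  "bell_encoding enc_channel
    \<and> pure_state (choi_state enc_channel)
    \<and> choi_state enc_channel = ketbra choi_vec choi_vec
    \<and> maximally_entangled choi_vec
    \<and> vn_entropy (ptrace_snd (choi_state enc_channel)) = 1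
    \<and> vn_entropy (ptrace_fst (choi_state enc_channel)) = 1
    \<and> vn_entropy (ptrace_snd (ketbra max_ent_vec (max_ent_vec :: complex ^ (spin \<times> spin)))) = 1
    \<and> vn_entropy (ptrace_fst (ketbra max_ent_vec (max_ent_vec :: complex ^ (spin \<times> spin)))) = 1
    \<and> (\<forall>\<Lambda>. bell_encoding \<Lambda> \<longrightarrow>
          vn_entropy (ptrace_snd (choi_state \<Lambda>)) \<le> 1 \<and>
          vn_entropy (ptrace_fst (choi_state \<Lambda>)) \<le> 1)"
proof (intro conjI allI impI)
  show "pure_state (choi_state enc_channel)"
    using choi_state_enc_channel norm_choi_vec by (auto simp: pure_state_def)
\<comment> \<open>The simplifier rewrites the Choi state to its \<open>ketbra\<close> form, so the
  entropy facts are also supplied in that form.\<close>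
qed (simp_all add: bell_encoding_enc_channel choi_state_enc_channel maximally_entangled_choi_vec
    bell_encoding_entropies vn_entropy_ptrace_fst_enc_channel ptrace_snd_max_ent_vec
    ptrace_fst_max_ent_vec vn_entropy_maximally_mixed_qubit
    bell_encoding_entropies(1)[OF bell_encoding_enc_channel, unfolded choi_state_enc_channel]
    vn_entropy_ptrace_fst_enc_channel[unfolded choi_state_enc_channel])

end
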